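(* Let $X$ be a finite rack with rack rank $N$. Then the $N$-degenerate chains form a subcomplex of the rack chain complex $C_*^R(X)=\{C_n^R(X),\partial_n\}$; that is, $\partial_n\big(C_n^{ND}(X)\big)\subseteq C_{n-1}^{ND}(X)$ for all $n$, where $C_n^{ND}(X)$ denotes the group of $N$-degenerate $n$-chains.
   Context: A rack is a set $X$ with two binary operations $\triangleright,\triangleright^{-1}$ such that for all $x,y,z\in X$: (i) $(x\triangleright y)\triangleright^{-1}y=x=(x\triangleright^{-1}y)\triangleright y$ and (ii) $(x\triangleright y)\triangleright z=(x\triangleright z)\triangleright(y\triangleright z)$. Rack powers are defined recursively by $x^{\triangleright 1}=x\triangleright x$ and $x^{\triangleright(k+1)}=x^{\triangleright k}\triangleright x^{\triangleright k}$; thus $x^{\triangleright k}=\pi^k(x)$, where $\pi:X\to X$, $\pi(x)=x\triangleright x$, is a bijection. For $x\in X$ let $N(x)$ be the smallest integer $N\ge 1$ with $x^{\triangleright N}=x$ (or $\infty$ if none exists). The rack rank of $X$ is $N=N(X)=\mathrm{lcm}\{N(x)\mid x\in X\}$; it is finite for finite racks. $C_n^R(X)$ is the free abelian group generated by $n$-tuples $(x_1,\dots,x_n)$ of elements of $X$ for $n\ge 1$, and $C_n^R(X)=0$ for $n<1$. The differential $\partial_n:C_n^R(X)\to C_{n-1}^R(X)$ is the linear map given on generators by $$\partial_n(x_1,\dots,x_n)=\sum_{i=2}^n(-1)^i\big[(x_1,\dots,x_{i-1},x_{i+1},\dots,x_n)-(x_1\triangleright x_i,\dots,x_{i-1}\triangleright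 x_i,x_{i+1},\dots,x_n)\big]$$ for $n\ge 2$, and $\partial_n=0$ for $n\le 1$. It is known that this is a chain complex. For $n\ge 2$, a chain in $C_n^R(X)$ is $N$-degenerate if it is a ($\mathbb{Z}$-)linear combination of chains of the form $$\sum_{k=1}^N(x_1,\dots,x_{i-1},x_i^{\triangleright k},x_i^{\triangleright(k+1)},x_{i+2},\dots,x_n)$$ with $1\le i\le n-1$ and $x_j\in X$. $C_n^{ND}(X)$ is the subgroup of $N$-degenerate $n$-chains for $n\ge 2$, and $C_n^{ND}(X)=0$ for $n\le 1$. *)

theory Defs
  imports Complex_Main "HOL-Algebra.Free_Abelian_Groups"
begin

locale rack =
  fixes X :: "'a set"
    and rop :: "'a \<Rightarrow> 'a \<Rightarrow> 'a"  (infixl "\<triangleright>" 70)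
    and rinv :: "'a \<Rightarrow> 'a \<Rightarrow> 'a"  (infixl "\<triangleright>\<inverse>" 70)
  assumes rop_closed: "\<lbrakk>x \<in> X; y \<in> X\<rbrakk> \<Longrightarrow> x \<triangleright> y \<in> X"
    and rinv_closed: "\<lbrakk>x \<in> X; y \<in> X\<rbrakk> \<Longrightarrow> x \<triangleright>\<inverse> y \<in> X"
    and rop_rinv: "\<lbrakk>x \<in> X; y \<in> X\<rbrakk> \<Longrightarrow> (x \<triangleright> y) \<triangleright>\<inverse> y = x"
    and rinv_rop: "\<lbrakk>x \<in> X; y \<in> X\<rbrakk> \<Longrightarrow> (x \<triangleright>\<inverse> y) \<triangleright> y = x"
    and self_distrib:
      "\<lbrakk>x \<in> X; y \<in> X; z \<in> X\<rbrakk> \<Longrightarrow> (x \<triangleright> y) \<triangleright> z = (x \<triangleright> z) \<triangleright> (y \<triangleright> z)"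

text \<open>The rack powers, with the recursion started at exponent 0, so that the first power of
  \<open>x\<close> is \<open>x \<triangleright> x\<close>. Note that the zeroth power is \<open>x\<close>.\<close>

primrec rack_power :: "('a \<Rightarrow> 'a \<Rightarrow> 'a) \<Rightarrow> 'a \<Rightarrow> nat \<Rightarrow> 'a" where
  "rack_power rop x 0 = x"
| "rack_power rop x (Suc k) = rop (rack_power rop x k) (rack_power rop x k)"

text \<open>The value 0 stands for infinity. It is the greatest element of the divisibility order on
  \<^typ>\<open>nat\<close>, and accordingly \<^const>\<open>Lcm\<close> returns 0 on every set that contains 0 or is infinite.\<close>

definition elem_rank :: "('a \<Rightarrow> 'a \<Rightarrow> 'a) \<Rightarrow> 'a \<Rightarrow> nat" where
  "elem_rank rop x =
     (if \<exists>N\<ge>1. rack_power rop x N = x then LEAST N. N \<ge> 1 \<and> rack_power rop x N = x else 0)"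

definition rack_rank :: "'a set \<Rightarrow> ('a \<Rightarrow> 'a \<Rightarrow> 'a) \<Rightarrow> nat" where
  "rack_rank X rop = (LCM x\<in>X. elem_rank rop x)"

text \<open>Tuples are lists, and chains are finitely supported integer-valued functions on lists.
  Degrees are integers. The basis is empty in degrees below 1, so the empty tuple is not a
  generator in degree 0.\<close>

definition rack_basis :: "'a set \<Rightarrow> int \<Rightarrow> 'a list set" where
  "rack_basis X n = {xs. n \<ge> 1 \<and> int (length xs) = n \<and> set xs \<subseteq> X}"

definition rack_chain_group :: "'a set \<Rightarrow> int \<Rightarrow> ('a list \<Rightarrow>\<^sub>0 int) monoid" where
  "rack_chain_group X n = free_Abelian_group (rack_basis X n)"

text \<open>Lists are indexed from 0: the \<open>i\<close>-th entry of a tuple is \<open>xs ! (i - 1)\<close>.\<close>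

definition rack_boundary_gen :: "('a \<Rightarrow> 'a \<Rightarrow> 'a) \<Rightarrow> 'a list \<Rightarrow> ('a list \<Rightarrow>\<^sub>0 int)" where
  "rack_boundary_gen rop xs =
     (\<Sum>i = 2..length xs. frag_cmul ((-1) ^ i)
        (frag_of (take (i - 1) xs @ drop i xs)
         - frag_of (map (\<lambda>x. rop x (xs ! (i - 1))) (take (i - 1) xs) @ drop i xs)))"

definition rack_boundary ::
    "('a \<Rightarrow> 'a \<Rightarrow> 'a) \<Rightarrow> int \<Rightarrow> ('a list \<Rightarrow>\<^sub>0 int) \<Rightarrow> ('a list \<Rightarrow>\<^sub>0 int)" where
  "rack_boundary rop n c = (if n \<ge> 2 then frag_extend (rack_boundary_gen rop) c else 0)"

interpretation frag_module: module frag_cmul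
  by unfold_locales (simp_all add: frag_cmul_distrib frag_cmul_distrib2)

text \<open>Here \<open>as\<close> and \<open>bs\<close> are the parts of the tuple before position \<open>i\<close> and after
  position \<open>i + 1\<close>.\<close>

definition degenerate_gens ::
    "'a set \<Rightarrow> ('a \<Rightarrow> 'a \<Rightarrow> 'a) \<Rightarrow> nat \<Rightarrow> int \<Rightarrow> ('a list \<Rightarrow>\<^sub>0 int) set" where
  "degenerate_gens X rop N n =
     {\<Sum>k = 1..N. frag_of (as @ [rack_power rop x k, rack_power rop x (k + 1)] @ bs) | as x bs.
        set as \<subseteq> X \<and> x \<in> X \<and> set bs \<subseteq> X \<and> int (length as + 2 + length bs) = n}"

definition degenerate_chains ::
    "'a set \<Rightarrow> ('a \<Rightarrow> 'a \<Rightarrow> 'a) \<Rightarrow> nat \<Rightarrow> int \<Rightarrow> ('a list \<Rightarrow>\<^sub>0 int) set" where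
  "degenerate_chains X rop N n =
     (if n \<ge> 2 then frag_module.span (degenerate_gens X rop N n) else {0})"

text \<open>In a finite rack the rank is a genuine positive integer.\<close>

lemma (in rack) rack_power_closed: "x \<in> X \<Longrightarrow> rack_power rop x k \<in> X"
  by (induction k) (auto intro: rop_closed)

lemma (in rack) rop_self_inj:
  assumes "x \<in> X" "y \<in> X" "x \<triangleright> x = y \<triangleright> y"
  shows "x = y"
proof -
  have act: "u \<triangleright> (z \<triangleright> z) = u \<triangleright> z" if "u \<in> X" "z \<in> X" for u z
    using self_distrib[of "u \<triangleright>\<inverse> z" z z] rinv_closed[OF that] rinv_rop[OF that] that(2)
    by simp
  have "x \<triangleright> x = y \<triangleright> x"
    using act[OF assms(2,1)] act[OF assms(2,2)] assms(3) by simp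
  then show ?thesis
    using rop_rinv assms(1,2) by metis
qed

lemma (in rack) rack_rank_pos:
  assumes "finite X"
  shows "rack_rank X rop > 0"
proof -
  have "elem_rank rop x > 0" if x: "x \<in> X" for x
  proof -
    have inj: "rack_power rop x (i + d) = rack_power rop x i \<Longrightarrow> rack_power rop x d = x" for i d
      by (induction i) (auto dest!: rop_self_inj[rotated 2] intro: rack_power_closed x)
    have "\<not> inj (rack_power rop x)"
      using finite_subset[OF _ assms, of "range (rack_power rop x)"] rack_power_closed[OF x]
        finite_imageD infinite_UNIV_nat by blast
    then obtain i j where "i < j" "rack_power rop x i = rack_power rop x j"
      unfolding inj_def by (metis linorder_neqE_nat)
    then have "\<exists>N\<ge>1. rack_power rop x N = x"
      using inj[of i "j - i"] by (intro exI[of _ "j - i"]) auto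
    then show ?thesis
      using LeastI_ex[of "\<lambda>N. N \<ge> 1 \<and> rack_power rop x N = x"]
      unfolding elem_rank_def by auto
  qed
  then have "0 \<notin> elem_rank rop ` X"
    by force
  then show ?thesis
    using assms by (simp add: rack_rank_def Lcm_0_iff neq0_conv[symmetric] del: neq0_conv)
qed

end

theory Submission
  imports Defs
begin

text \<open>Faces at positions away from the two adjacent powers map a degenerate generator to a
  degenerate generator, since right translations are rack endomorphisms and so commute with rack
  powers. At the two remaining positions, \<open>x\<^sup>k\<close> and \<open>x\<^sup>k\<^sup>+\<^sup>1\<close> act in the same way
  and \<open>x\<^sup>k \<triangleright> x\<^sup>k\<^sup>+\<^sup>1 = x\<^sup>k\<^sup>+\<^sup>1\<close>, so the twisted faces cancel, while the untwisted ones
  telescope over \<open>k\<close> to \<open>x\<^sup>N\<^sup>+\<^sup>1 - x\<^sup>1\<close>, which vanishes by the choice of \<open>N\<close>.\<close>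

section \<open>Rack powers and the rank\<close>

lemma rack_power_add:
  "rack_power rop x (m + n) = rack_power rop (rack_power rop x m) n"
  by (induction n) simp_all

text \<open>The value 0 that stands for an infinite rank does no harm, since the zeroth power is
  \<open>x\<close> itself.\<close>

lemma rack_power_elem_rank: "rack_power rop x (elem_rank rop x) = x"
proof (cases "\<exists>N\<ge>1. rack_power rop x N = x")
  case True
  then show ?thesis
    using LeastI_ex[OF True] by (simp add: elem_rank_def)
next
  case False
  then show ?thesis
    by (simp only: elem_rank_def if_False rack_power.simps)
qed

text \<open>The rank is a multiple of \<open>elem_rank rop x\<close>, and iterating a power that
  fixes \<open>x\<close> still fixes \<open>x\<close>.\<close>

lemma rack_power_rack_rank:
  assumes "x \<in> X"
  shows "rack_power rop x (rack_rank X rop) = x"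
proof -
  have "elem_rank rop x dvd rack_rank X rop"
    using assms by (simp add: rack_rank_def)
  then obtain m where m: "rack_rank X rop = elem_rank rop x * m" ..
  have "rack_power rop x (elem_rank rop x * m) = x"
    by (induction m) (simp_all add: rack_power_add rack_power_elem_rank)
  then show ?thesis
    by (simp add: m)
qed

context rack
begin

text \<open>Write \<open>u\<close> as \<open>w \<triangleright> z\<close> with
  \<open>w = u \<triangleright>\<inverse> z\<close>; distributivity for \<open>w\<close>,
  \<open>z\<close>, \<open>z\<close> is then the claim. Consequently all rack powers of an element
  act alike from the right.\<close>

lemma rop_square:
  assumes "u \<in> X" "z \<in> X"
  shows "u \<triangleright> (z \<triangleright> z) = u \<triangleright> z"
  using self_distrib[of "u \<triangleright>\<inverse> z" z z] rinv_closed[OF assms] rinv_rop[OF assms] assms(2)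
  by simp

text \<open>By self-distributivity, right translation by \<open>b\<close> is an endomorphism, so it
  passes through each squaring step of the power.\<close>

lemma rack_power_rop:
  assumes "x \<in> X" "b \<in> X"
  shows "rack_power rop x k \<triangleright> b = rack_power rop (x \<triangleright> b) k"
  by (induction k) (use assms in \<open>simp_all add: self_distrib rack_power_closed\<close>)

end

section \<open>Faces of tuples\<close>

definition face :: "nat \<Rightarrow> 'a list \<Rightarrow> 'a list" where
  "face i xs = take i xs @ drop (Suc i) xs"

definition twisted_face :: "('a \<Rightarrow> 'a \<Rightarrow> 'a) \<Rightarrow> nat \<Rightarrow> 'a list \<Rightarrow> 'a list" where
  "twisted_face rop i xs = map (\<lambda>x. rop x (xs ! i)) (take i xs) @ drop (Suc i) xs"

text \<open>The term for position 0 is included because it vanishes.\<close>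

lemma rack_boundary_gen_faces:
  "rack_boundary_gen rop xs =
     (\<Sum>i<length xs. frag_cmul ((-1) ^ Suc i) (frag_of (face i xs) - frag_of (twisted_face rop i xs)))"
    (is "_ = sum ?g _")
proof -
  \<comment> \<open>Here \<open>i\<close> is a 0-based position, one less than the index in the
    boundary formula; hence the exponent \<open>Suc i\<close> of the sign.\<close>
  have "rack_boundary_gen rop xs = (\<Sum>i\<in>{1..<length xs}. ?g i)"
    unfolding rack_boundary_gen_def face_def twisted_face_def
    by (rule sum.reindex_bij_witness[of _ Suc "\<lambda>i. i - 1"]) auto
  also have "\<dots> = (\<Sum>i<length xs. ?g i)"
  proof (rule sum.mono_neutral_left)
    \<comment> \<open>No entry precedes position 0, so there is nothing to translate and the two
      faces coincide.\<close>
    have "?g 0 = 0"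
      by (simp only: face_def twisted_face_def take_0 list.map diff_self frag_cmul_zero2)
    moreover have "i = 0" if "i \<in> {..<length xs} - {1..<length xs}" for i
      using that by auto
    ultimately show "\<forall>i\<in>{..<length xs} - {1..<length xs}. ?g i = 0"
      by metis
  qed auto
  finally show ?thesis .
qed

lemma face_append_left: "i < length as \<Longrightarrow> face i (as @ cs) = face i as @ cs"
  by (simp add: face_def)

lemma face_append_right: "face (length as + i) (as @ cs) = as @ face i cs"
  by (simp add: face_def flip: add_Suc_right)

lemma twisted_face_append_left:
  "i < length as \<Longrightarrow> twisted_face rop i (as @ cs) = twisted_face rop i as @ cs"
  by (simp add: twisted_face_def nth_append)

lemma twisted_face_append_right:
  "twisted_face rop (length as + i) (as @ cs) =
     map (\<lambda>x. rop x (cs ! i)) as @ twisted_face rop i cs"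
  by (simp add: twisted_face_def nth_append flip: add_Suc_right)

lemma length_face: "i < length xs \<Longrightarrow> length (face i xs) = length xs - 1"
  by (simp add: face_def)

lemma length_twisted_face: "i < length xs \<Longrightarrow> length (twisted_face rop i xs) = length xs - 1"
  by (simp add: twisted_face_def)

lemma set_face_subset: "set xs \<subseteq> X \<Longrightarrow> set (face i xs) \<subseteq> X"
  using set_take_subset set_drop_subset by (fastforce simp: face_def)

lemma (in rack) set_twisted_face_subset:
  "\<lbrakk>set xs \<subseteq> X; i < length xs\<rbrakk> \<Longrightarrow> set (twisted_face rop i xs) \<subseteq> X"
  using set_take_subset[of i xs] set_drop_subset[of "Suc i" xs] nth_mem[of i xs]
  by (auto simp: twisted_face_def intro!: rop_closed)

section \<open>Degenerate chains as spans\<close>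

lemma degenerate_gensI:
  assumes "set as \<subseteq> X" "x \<in> X" "set bs \<subseteq> X" "int (length as + 2 + length bs) = n"
    and "\<And>k. f k = as @ [rack_power rop x k, rack_power rop x (k + 1)] @ bs"
  shows "(\<Sum>k = 1..N. frag_of (f k)) \<in> degenerate_gens X rop N n"
  unfolding degenerate_gens_def assms(5) using assms(1-4) by blast

text \<open>A generator has at least two entries, so below degree 2 the span is that of the empty
  set, namely zero. This removes the case split on the degree.\<close>

lemma degenerate_chains_eq_span:
  "degenerate_chains X rop N n = frag_module.span (degenerate_gens X rop N n)"
proof (cases "n \<ge> 2")
  case False
  then have "degenerate_gens X rop N n = {}"
    by (auto simp: degenerate_gens_def)
  then show ?thesis
    using False by (simp add: degenerate_chains_def)
qed (simp add: degenerate_chains_def)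

text \<open>A span is closed under the group operations; what remains is that supports stay inside
  the basis, which passes from the generators to their combinations.\<close>

lemma (in rack) degenerate_chains_subgroup:
  "subgroup (degenerate_chains X rop N n) (rack_chain_group X n)"
proof -
  have gens: "Poly_Mapping.keys g \<subseteq> rack_basis X n" if g: "g \<in> degenerate_gens X rop N n" for g
  proof -
    obtain as x bs where
      g_eq: "g = (\<Sum>k = 1..N. frag_of (as @ [rack_power rop x k, rack_power rop x (k + 1)] @ bs))"
      and "set as \<subseteq> X" "x \<in> X" "set bs \<subseteq> X" "int (length as + 2 + length bs) = n"
      using g unfolding degenerate_gens_def by blast
    then have "as @ [rack_power rop x k, rack_power rop x (k + 1)] @ bs \<in> rack_basis X n" for k
      using rack_power_closed[of x k] by (auto simp: rack_basis_def intro: rop_closed)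
    then show ?thesis
      unfolding g_eq by (intro order.trans[OF keys_sum]) auto
  qed
  have "Poly_Mapping.keys c \<subseteq> rack_basis X n"
    if "c \<in> frag_module.span (degenerate_gens X rop N n)" for c
    using that
  proof (induction rule: frag_module.span_induct_alt)
    case (step r g c)
    then show ?case
      using gens[of g] keys_add[of "frag_cmul r g" c] keys_cmul[of r g] by blast
  qed simp
  then show ?thesis
    unfolding degenerate_chains_eq_span rack_chain_group_def
    by (intro group.subgroupI)
      (auto intro: frag_module.span_add frag_module.span_neg frag_module.span_zero)
qed

section \<open>The boundary of a degenerate generator\<close>

lemma (in rack) degenerate_faces_in_span:
  fixes as bs :: "'a list" and x :: 'a and N :: nat
  defines "xs k \<equiv> as @ [rack_power rop x k, rack_power rop x (k + 1)] @ bs"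
  assumes as: "set as \<subseteq> X" and x: "x \<in> X" and bs: "set bs \<subseteq> X"
    and n: "int (length as + 2 + length bs) = n"
    and i: "i < length as + 2 + length bs" "i \<noteq> length as" "i \<noteq> Suc (length as)"
  shows "(\<Sum>k = 1..N. frag_of (face i (xs k)) - frag_of (twisted_face rop i (xs k)))
      \<in> frag_module.span (degenerate_gens X rop N (n - 1))"
proof -
  have "(\<Sum>k = 1..N. frag_of (face i (xs k))) \<in> degenerate_gens X rop N (n - 1) \<and>
        (\<Sum>k = 1..N. frag_of (twisted_face rop i (xs k))) \<in> degenerate_gens X rop N (n - 1)"
  proof (cases "i < length as")
    \<comment> \<open>Both faces alter only \<open>as\<close>, because translation affects only
      entries to the left of position \<open>i\<close>.\<close>
    case True
    have len: "int (length as - 1 + 2 + length bs) = n - 1"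
      using True n by linarith
    show ?thesis
    proof
      show "(\<Sum>k = 1..N. frag_of (face i (xs k))) \<in> degenerate_gens X rop N (n - 1)"
        by (rule degenerate_gensI[where as = "face i as"])
          (use True as x bs len in \<open>simp_all add: xs_def face_append_left length_face set_face_subset\<close>)
      show "(\<Sum>k = 1..N. frag_of (twisted_face rop i (xs k))) \<in> degenerate_gens X rop N (n - 1)"
        by (rule degenerate_gensI[where as = "twisted_face rop i as"])
          (use True as x bs len in \<open>simp_all add: xs_def twisted_face_append_left
             length_twisted_face set_twisted_face_subset\<close>)
    qed
  next
    case False
    \<comment> \<open>The deleted entry is \<open>bs ! j\<close>. The twisted face translates the
      adjacent pair as well, giving the powers of \<open>x \<triangleright> (bs ! j)\<close> in
      place of those of \<open>x\<close>.\<close>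
    define j where "j = i - (length as + 2)"
    have i_eq: "i = length as + Suc (Suc j)" and j: "j < length bs"
      using False i by (auto simp: j_def)
    then have b: "bs ! j \<in> X"
      using bs nth_mem by blast
    have len: "int (length as + 2 + (length bs - 1)) = n - 1"
      using j n by linarith
    have face: "face i (xs k) = as @ [rack_power rop x k, rack_power rop x (k + 1)] @ face j bs" for k
      unfolding xs_def i_eq face_append_right by (simp add: face_def)
    have twisted: "twisted_face rop i (xs k) =
        map (\<lambda>a. a \<triangleright> (bs ! j)) as @
        [rack_power rop (x \<triangleright> (bs ! j)) k, rack_power rop (x \<triangleright> (bs ! j)) (k + 1)] @
        twisted_face rop j bs" for k
      using rack_power_rop[OF x b, of k] rack_power_rop[OF x b, of "k + 1"]
      unfolding xs_def i_eq twisted_face_append_right by (simp add: twisted_face_def)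
    show ?thesis
    proof
      show "(\<Sum>k = 1..N. frag_of (face i (xs k))) \<in> degenerate_gens X rop N (n - 1)"
        by (rule degenerate_gensI[OF _ _ _ _ face])
          (use as x bs j len in \<open>simp_all add: length_face set_face_subset\<close>)
      show "(\<Sum>k = 1..N. frag_of (twisted_face rop i (xs k))) \<in> degenerate_gens X rop N (n - 1)"
        by (rule degenerate_gensI[OF _ _ _ _ twisted])
          (use as x bs b j len in \<open>auto simp: length_twisted_face set_twisted_face_subset
             intro: rop_closed dest: set_twisted_face_subset[THEN subsetD]\<close>)
    qed
  qed
  then show ?thesis
    by (auto simp: sum_subtractf intro: frag_module.span_diff frag_module.span_base)
qed

text \<open>The positions \<open>p\<close> and \<open>Suc p\<close> carry opposite signs in the
  boundary, so this equality becomes a cancellation there.\<close>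

lemma (in rack) degenerate_middle_faces:
  fixes as bs :: "'a list" and x :: 'a and N :: nat
  defines "xs k \<equiv> as @ [rack_power rop x k, rack_power rop x (k + 1)] @ bs"
    and "p \<equiv> length as"
  assumes as: "set as \<subseteq> X" and x: "x \<in> X" and N: "rack_power rop x N = x"
  shows "(\<Sum>k = 1..N. frag_of (face (Suc p) (xs k)) - frag_of (twisted_face rop (Suc p) (xs k)))
       = (\<Sum>k = 1..N. frag_of (face p (xs k)) - frag_of (twisted_face rop p (xs k)))"
proof -
  define h where "h k = as @ rack_power rop x k # bs" for k
  have faces: "face p (xs k) = h (Suc k)" "face (Suc p) (xs k) = h k" for k
    using face_append_right[of as 0] face_append_right[of as 1]
    by (simp_all add: xs_def p_def h_def) (simp_all add: face_def)
  \<comment> \<open>Both powers translate \<open>as\<close> alike, and the surviving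
    \<open>x^k\<close>, translated by \<open>x^(k+1)\<close>, becomes \<open>x^(k+1)\<close>, the
    entry that the face at \<open>p\<close> retains.\<close>
  have twisted: "twisted_face rop (Suc p) (xs k) = twisted_face rop p (xs k)" for k
  proof -
    have "map (\<lambda>a. a \<triangleright> rack_power rop x (Suc k)) as = map (\<lambda>a. a \<triangleright> rack_power rop x k) as"
      using as x by (auto simp: rop_square rack_power_closed)
    moreover have "rack_power rop x k \<triangleright> rack_power rop x (Suc k) = rack_power rop x (Suc k)"
      using x by (simp add: rop_square rack_power_closed)
    ultimately show ?thesis
      by (simp add: xs_def p_def twisted_face_def nth_append)
  qed
  have "(\<Sum>k = 1..N. frag_of (h (Suc k)) - frag_of (h k)) = frag_of (h (Suc N)) - frag_of (h 1)"
    by (rule sum_Suc_diff) simp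
  \<comment> \<open>The power \<open>Suc N\<close> squares \<open>x^N = x\<close>, which gives the
    first power.\<close>
  also have "h (Suc N) = h 1"
    using N by (simp add: h_def)
  finally show ?thesis
    by (simp add: faces twisted sum_subtractf)
qed

lemma (in rack) rack_boundary_degenerate_gens:
  assumes g: "g \<in> degenerate_gens X rop (rack_rank X rop) n"
  shows "frag_extend (rack_boundary_gen rop) g
      \<in> frag_module.span (degenerate_gens X rop (rack_rank X rop) (n - 1))"
proof -
  define N where "N = rack_rank X rop"
  obtain as x bs where
    g_eq: "g = (\<Sum>k = 1..N. frag_of (as @ [rack_power rop x k, rack_power rop x (k + 1)] @ bs))"
    and as: "set as \<subseteq> X" and x: "x \<in> X" and bs: "set bs \<subseteq> X"
    and n: "int (length as + 2 + length bs) = n"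
    using g unfolding degenerate_gens_def N_def by blast
  define xs where "xs k = as @ [rack_power rop x k, rack_power rop x (k + 1)] @ bs" for k
  define p where "p = length as"
  define L where "L = length as + 2 + length bs"
  define F where
    "F i = (\<Sum>k = 1..N. frag_of (face i (xs k)) - frag_of (twisted_face rop i (xs k)))" for i
  have "F (Suc p) = F p"
    unfolding F_def xs_def p_def
    by (rule degenerate_middle_faces) (use as x rack_power_rack_rank[OF x] in \<open>simp_all add: N_def\<close>)
  then have middle: "(\<Sum>i\<in>{p, Suc p}. frag_cmul ((-1) ^ Suc i) (F i)) = 0"
    \<comment> \<open>As simp rules, the two deleted facts rewrite in opposite directions and loop.\<close>
    by (simp add: frag_cmul_distrib[symmetric] del: minus_frag_cmul frag_module.scale_minus_left)
  have length_xs: "length (xs k) = L" for k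
    by (simp add: xs_def L_def)
  have "frag_extend (rack_boundary_gen rop) g = (\<Sum>k = 1..N. rack_boundary_gen rop (xs k))"
    by (simp add: g_eq xs_def frag_extend_sum)
  also have "\<dots> = (\<Sum>k = 1..N. \<Sum>i<L. frag_cmul ((-1) ^ Suc i)
      (frag_of (face i (xs k)) - frag_of (twisted_face rop i (xs k))))"
    by (simp only: rack_boundary_gen_faces length_xs)
  \<comment> \<open>The sign does not depend on \<open>k\<close>, so exchanging the sums collects
    the contributions of each position into \<open>F i\<close>.\<close>
  also have "\<dots> = (\<Sum>i<L. frag_cmul ((-1) ^ Suc i) (F i))"
    by (subst sum.swap) (simp only: F_def frag_cmul_sum)
  also have "\<dots> = (\<Sum>i\<in>{..<L} - {p, Suc p}. frag_cmul ((-1) ^ Suc i) (F i)) +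
      (\<Sum>i\<in>{p, Suc p}. frag_cmul ((-1) ^ Suc i) (F i))"
    by (rule sum.subset_diff) (auto simp: L_def p_def)
  also have "\<dots> = (\<Sum>i\<in>{..<L} - {p, Suc p}. frag_cmul ((-1) ^ Suc i) (F i))"
    by (simp only: middle add_0_right)
  finally have boundary: "frag_extend (rack_boundary_gen rop) g =
      (\<Sum>i\<in>{..<L} - {p, Suc p}. frag_cmul ((-1) ^ Suc i) (F i))" .
  have "F i \<in> frag_module.span (degenerate_gens X rop N (n - 1))" if "i \<in> {..<L} - {p, Suc p}" for i
    unfolding F_def xs_def
    by (rule degenerate_faces_in_span[OF as x bs n]) (use that in \<open>auto simp: L_def p_def\<close>)
  then show ?thesis
    unfolding boundary N_def[symmetric]
    by (intro frag_module.span_sum frag_module.span_scale)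
qed

theorem theorem2:
  fixes X :: "'a set" and rop rinv :: "'a \<Rightarrow> 'a \<Rightarrow> 'a" and N :: nat
  assumes "rack X rop rinv"
    and "finite X"
    and "N = rack_rank X rop"
  shows "\<forall>n::int. subgroup (degenerate_chains X rop N n) (rack_chain_group X n) \<and>
           rack_boundary rop n ` degenerate_chains X rop N n \<subseteq> degenerate_chains X rop N (n - 1)"
proof (intro allI conjI image_subsetI)
  interpret rack X rop rinv by fact
  fix n :: int
  show "subgroup (degenerate_chains X rop N n) (rack_chain_group X n)"
    by (rule degenerate_chains_subgroup)
  fix c assume "c \<in> degenerate_chains X rop N n"
  then have "c \<in> frag_module.span (degenerate_gens X rop N n)"
    by (simp add: degenerate_chains_eq_span)
  then have "frag_extend (rack_boundary_gen rop) c
      \<in> frag_module.span (degenerate_gens X rop N (n - 1))"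
  \<comment> \<open>\<open>frag_extend\<close> is linear, so the result for generators extends to
    their span.\<close>
  proof (induction rule: frag_module.span_induct_alt)
    case base
    then show ?case
      by (simp add: frag_module.span_zero)
  next
    case (step r g c)
    then show ?case
      using rack_boundary_degenerate_gens assms(3)
      by (simp add: frag_extend_add frag_extend_cmul frag_module.span_add frag_module.span_scale)
  qed
  \<comment> \<open>For \<open>n < 2\<close> the boundary is 0 by definition, and 0 lies in every
    span.\<close>
  then show "rack_boundary rop n c \<in> degenerate_chains X rop N (n - 1)"
    by (simp add: rack_boundary_def degenerate_chains_eq_span frag_module.span_zero)
qed

end
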